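(* Let $x\in\mathbb{C}$. Then for all integers $n\geq 1$, $$\sum_{k=0}^n \binom{n+k}{2k} \binom{2k}{k} \frac{2^{-2k}}{n+k}\, x^k = \frac{(-1)^n}{2n} \left( P_n\left(-\frac{x+2}{2}\right) - P_{n-1}\left(-\frac{x+2}{2}\right)\right),$$ where $P_n$ denotes the $n$th Legendre polynomial.
   Context: The Legendre polynomials $P_n(x)$, $n=0,1,2,\ldots$, are defined by Rodrigues' formula $P_n(x) = \frac{1}{n!\,2^n} \frac{d^n}{dx^n}\left((x^2-1)^n\right)$; thus $P_0(x)=1$, $P_1(x)=x$, $P_2(x)=\frac{3x^2-1}{2}$. *)

theory Defs
  imports Complex_Main "HOL-Computational_Algebra.Polynomial"
begin

text \<open>Rodrigues' formula, with the formal derivative of polynomials.\<close>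
definition legendre_poly :: "nat \<Rightarrow> 'a :: field_char_0 poly" where
  "legendre_poly n = smult (1 / (fact n * 2 ^ n)) ((pderiv ^^ n) ([:-1, 0, 1:] ^ n))"

end

theory Submission
  imports Defs
begin

text \<open>
  Both sides are polynomials in \<open>x\<close>, and \<open>-(x+2)/2 = -1 - x/2\<close>, so the right-hand side asks for the
  Taylor expansion of the Legendre polynomials at the point \<open>-1\<close>. There Rodrigues' formula is easy to
  evaluate: substituting \<open>X = u - 1\<close> turns \<open>(X\<^sup>2 - 1)\<^sup>n\<close> into \<open>u\<^sup>n (u - 2)\<^sup>n\<close>, whose binomial expansion
  can be differentiated \<open>n\<close> times term by term. With \<open>u = -x/2\<close> this gives
  \<open>P\<^sub>n(-(x+2)/2) = (-1)\<^sup>n (\<Sum>k\<le>n. (n choose k) (n+k choose k) (x/4)\<^sup>k)\<close>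
  (lemma \<open>legendre_poly_expansion_at_minus_one\<close>). Because of the sign \<open>(-1)\<^sup>n\<close>, the difference
  \<open>P\<^sub>n - P\<^sub>n\<^sub>-\<^sub>1\<close> becomes a sum of coefficients, and these combine through
  \<open>(n choose k) (n+k choose k) = (n+k)! / (k!\<^sup>2 (n-k)!)\<close> and \<open>(n + k) + (n - k) = 2n\<close>
  (lemma \<open>legendre_coeff_add_pred\<close>).
\<close>

lemma higher_pderiv_monom_shift:
  "(pderiv ^^ n) (monom c (n + k)) = monom (pochhammer (of_nat k + 1) n * c) k"
  by (rule poly_eqI) (simp add: coeff_higher_pderiv add.commute)

lemma higher_pderiv_pcompose_shift:
  fixes p :: "'a :: idom poly"
  shows "(pderiv ^^ n) (pcompose p [:c, 1:]) = pcompose ((pderiv ^^ n) p) [:c, 1:]"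
  by (induction n) (simp_all add: pderiv_pcompose pderiv_pCons)

text \<open>The substitution \<open>X = u - 1\<close> splits off the factor \<open>u\<^sup>n\<close>, so every term survives the \<open>n\<close>-fold
  derivative in Rodrigues' formula.\<close>

lemma rodrigues_base_shift:
  "pcompose ([:-1, 0, 1:] ^ n) [:-1, 1:]
     = (\<Sum>k\<le>n. monom (of_nat (n choose k) * (- 2) ^ (n - k)) (n + k) :: 'a :: field_char_0 poly)"
proof -
  have "pcompose [:-1, 0, 1:] [:-1, 1:] = ([:0, -2, 1:] :: 'a poly)"
    by (simp add: pcompose_pCons)
  then have "pcompose ([:-1, 0, 1:] ^ n) [:-1, 1:] = ([:0, -2, 1:] :: 'a poly) ^ n"
    by (induction n) (simp_all add: pcompose_mult pcompose_1 del: mult_pCons_left mult_pCons_right)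
  also have "[:0, -2, 1:] = (monom 1 1 * (monom 1 1 + [:-2:]) :: 'a poly)"
    by (simp add: monom_altdef)
  also have "\<dots> ^ n = (\<Sum>k\<le>n. monom 1 n * (of_nat (n choose k) * monom 1 k * [:(- 2) ^ (n - k):]))"
    by (simp add: power_mult_distrib binomial_ring sum_distrib_left monom_power poly_const_pow)
  also have "\<dots> = (\<Sum>k\<le>n. monom (of_nat (n choose k) * (- 2) ^ (n - k)) (n + k))"
    by (intro sum.cong refl) (simp add: of_nat_poly mult_monom smult_monom mult.commute)
  finally show ?thesis .
qed

text \<open>The \<open>n\<close>-fold derivative turns \<open>u\<^sup>n\<^sup>+\<^sup>k\<close> into \<open>(n+k)!/k! u\<^sup>k\<close>; dividing by the \<open>n!\<close> of Rodrigues'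
  formula leaves \<open>n+k choose k\<close>, and dividing \<open>(-2)\<^sup>n\<^sup>-\<^sup>k\<close> by \<open>2\<^sup>n\<close> leaves \<open>(-1)\<^sup>n (-1/2)\<^sup>k\<close>.\<close>

lemma legendre_poly_expansion_at_minus_one:
  fixes u :: "'a :: field_char_0"
  shows "poly (legendre_poly n) (u - 1)
     = (- 1) ^ n * (\<Sum>k\<le>n. of_nat ((n choose k) * ((n + k) choose k)) * (- u / 2) ^ k)"
proof -
  have "poly (legendre_poly n) (u - 1)
      = poly (pcompose ((pderiv ^^ n) ([:-1, 0, 1:] ^ n)) [:-1, 1:]) u / (fact n * 2 ^ n)"
    by (simp add: legendre_poly_def poly_pcompose)
  also have "\<dots> = poly ((pderiv ^^ n) (pcompose ([:-1, 0, 1:] ^ n) [:-1, 1:])) u / (fact n * 2 ^ n)"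
    by (simp only: higher_pderiv_pcompose_shift)
  also have "\<dots> = (\<Sum>k\<le>n. pochhammer (of_nat k + 1) n
                * (of_nat (n choose k) * (- 2) ^ (n - k)) * u ^ k) / (fact n * 2 ^ n)"
    by (simp add: rodrigues_base_shift higher_pderiv_sum higher_pderiv_monom_shift poly_sum poly_monom)
  also have "\<dots> = (- 1) ^ n * (\<Sum>k\<le>n. of_nat ((n choose k) * ((n + k) choose k)) * (- u / 2) ^ k)"
    unfolding sum_divide_distrib sum_distrib_left
  proof (intro sum.cong refl)
    fix k assume "k \<in> {..n}"
    then obtain j where n: "n = j + k" by (metis atMost_iff le_add_diff_inverse2)
    have "fact k * pochhammer (of_nat k + 1) n = (fact (k + n) :: 'a)"
      by (simp add: pochhammer_fact pochhammer_product' add.commute)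
    then have choose: "pochhammer (of_nat k + 1) n / fact n = (of_nat ((n + k) choose k) :: 'a)"
      by (simp add: binomial_fact field_simps)
    have pow: "(- 2) ^ (n - k) * u ^ k / 2 ^ n = (- 1) ^ n * (- u / 2) ^ k"
      unfolding n add_diff_cancel_right' power_add power_divide power_minus[of u] power_minus[of 2]
      by simp
    have "pochhammer (of_nat k + 1) n * (of_nat (n choose k) * (- 2) ^ (n - k)) * u ^ k
            / (fact n * 2 ^ n)
        = of_nat (n choose k) * (pochhammer (of_nat k + 1) n / fact n)
            * ((- 2) ^ (n - k) * u ^ k / 2 ^ n)"
      by (simp add: mult_ac)
    then show "pochhammer (of_nat k + 1) n * (of_nat (n choose k) * (- 2) ^ (n - k)) * u ^ k
            / (fact n * 2 ^ n)
        = (- 1) ^ n * (of_nat ((n choose k) * ((n + k) choose k)) * (- u / 2) ^ k)"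
      unfolding choose pow by (simp add: mult_ac)
  qed
  finally show ?thesis .
qed

lemma legendre_coeff_fact:
  assumes "k \<le> n"
  shows "of_nat ((n choose k) * ((n + k) choose k))
       = (fact (n + k) / (fact k ^ 2 * fact (n - k)) :: 'a :: field_char_0)"
  using assms by (simp add: binomial_fact power2_eq_square)

text \<open>Over the common denominator \<open>k!\<^sup>2 (n-k)!\<close> the two numerators are \<open>(n+k-1)!\<close> times \<open>n + k\<close> and
  \<open>n - k\<close>, so their sum is \<open>2n/(n+k)\<close> times the first one. For \<open>k = n\<close> the second summand
  vanishes, in accordance with \<open>n - k = 0\<close>.\<close>

lemma legendre_coeff_add_pred:
  assumes "n \<ge> 1" "k \<le> n"
  shows "of_nat ((n choose k) * ((n + k) choose k)) + of_nat ((n - 1 choose k) * ((n - 1 + k) choose k))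
       = (2 * of_nat n / of_nat (n + k)) * (of_nat ((n + k choose 2 * k) * (2 * k choose k)) :: 'a :: field_char_0)"
proof -
  obtain m where n: "n = Suc m" using assms(1) by (cases n) auto
  have nz: "of_nat (n + k) \<noteq> (0 :: 'a)" unfolding of_nat_eq_0_iff by (simp add: n)
  have F: "fact (n + k) = (of_nat (n + k) * fact (m + k) :: 'a)" by (simp add: n)
  define r :: 'a where "r = fact (m + k) / (fact k ^ 2 * fact (n - k))"
  have upper: "of_nat ((n choose k) * ((n + k) choose k)) = of_nat (n + k) * r"
    unfolding legendre_coeff_fact[OF assms(2)] F r_def by simp
  have lower: "of_nat ((n - 1 choose k) * ((n - 1 + k) choose k)) = of_nat (n - k) * r"
  proof (cases "k = n")
    case True
    then show ?thesis by (simp add: n)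
  next
    case False
    then have km: "k \<le> m" using assms(2) n by simp
    then have f: "fact (n - k) = (of_nat (n - k) * fact (m - k) :: 'a)"
      by (simp add: n Suc_diff_le)
    have nk: "of_nat (n - k) \<noteq> (0 :: 'a)"
      unfolding of_nat_eq_0_iff using km n by simp
    have "of_nat ((m choose k) * ((m + k) choose k)) = of_nat (n - k) * r"
      unfolding legendre_coeff_fact[OF km] r_def f using nk by (simp del: of_nat_diff of_nat_eq_0_iff)
    then show ?thesis by (simp add: n)
  qed
  have upper': "of_nat (n + k) * r = of_nat ((n + k choose 2 * k) * (2 * k choose k))"
    using choose_mult[of k "2 * k" "n + k"] assms(2) unfolding upper[symmetric]
    by (simp add: mult.commute)
  have "of_nat (n + k) * r + of_nat (n - k) * r = of_nat ((n + k) + (n - k)) * r"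
    by (simp only: of_nat_add distrib_right)
  also have "(n + k) + (n - k) = 2 * n" using assms(2) by simp
  also have "of_nat (2 * n) * r = (2 * of_nat n / of_nat (n + k)) * (of_nat (n + k) * r)"
    using nz by (simp del: of_nat_add of_nat_eq_0_iff)
  finally show ?thesis unfolding upper lower upper' .
qed

theorem theorem2p2:
  fixes x :: complex and n :: nat
  assumes "n \<ge> 1"
  shows "(\<Sum>k=0..n. of_nat ((n + k) choose (2 * k)) * of_nat ((2 * k) choose k)
            * (2 powi (- 2 * int k) / of_nat (n + k)) * x ^ k)
       = (- 1) ^ n / (2 * of_nat n)
         * (poly (legendre_poly n) (- ((x + 2) / 2)) - poly (legendre_poly (n - 1)) (- ((x + 2) / 2)))"
proof -
  define c :: "nat \<Rightarrow> nat \<Rightarrow> complex" where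
    "c m k = of_nat ((m choose k) * ((m + k) choose k))" for m k
  have P: "poly (legendre_poly m) (- ((x + 2) / 2)) = (- 1) ^ m * (\<Sum>k\<le>m. c m k * (x / 4) ^ k)" for m
  proof -
    have "- ((x + 2) / 2) = - x / 2 - 1" by (simp add: field_simps)
    then show ?thesis
      using legendre_poly_expansion_at_minus_one[of m "- x / 2"] by (simp add: c_def)
  qed
  \<comment> \<open>The missing term \<open>k = n\<close> of the lower sum is zero, so both sums may run over the same range.\<close>
  have ext: "(\<Sum>k\<le>n - 1. c (n - 1) k * (x / 4) ^ k) = (\<Sum>k\<le>n. c (n - 1) k * (x / 4) ^ k)"
    by (rule sum.mono_neutral_left) (auto simp: c_def)
  have sgn: "(- 1) ^ (n - 1) = - ((- 1) ^ n :: complex)"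
    using assms by (cases n) auto
  have "(- 1) ^ n / (2 * of_nat n)
          * (poly (legendre_poly n) (- ((x + 2) / 2)) - poly (legendre_poly (n - 1)) (- ((x + 2) / 2)))
      = ((- 1) ^ n * (- 1) ^ n) / (2 * of_nat n)
          * ((\<Sum>k\<le>n. c n k * (x / 4) ^ k) + (\<Sum>k\<le>n. c (n - 1) k * (x / 4) ^ k))"
    unfolding P ext sgn by (simp add: algebra_simps)
  also have "\<dots> = (\<Sum>k\<le>n. (c n k + c (n - 1) k) * (x / 4) ^ k / (2 * of_nat n))"
    by (simp add: sum.distrib sum_divide_distrib add_divide_distrib distrib_right
             flip: power_mult_distrib)
  also have "\<dots> = (\<Sum>k\<le>n. of_nat ((n + k) choose (2 * k)) * of_nat ((2 * k) choose k)
            * (2 powi (- 2 * int k) / of_nat (n + k)) * x ^ k)"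
  proof (intro sum.cong refl)
    fix k assume "k \<in> {..n}"
    then have "c n k + c (n - 1) k
        = (2 * of_nat n / of_nat (n + k)) * of_nat ((n + k choose 2 * k) * (2 * k choose k))"
      unfolding c_def using legendre_coeff_add_pred[OF assms] by simp
    moreover have "(2 :: complex) powi (- 2 * int k) = 1 / 4 ^ k"
    proof -
      have "(2 :: complex) powi (- 2 * int k) = inverse (2 powi int (2 * k))"
        by (simp add: power_int_minus)
      also have "\<dots> = 1 / 4 ^ k"
        unfolding power_int_of_nat power_mult by (simp add: field_simps)
      finally show ?thesis .
    qed
    ultimately show "(c n k + c (n - 1) k) * (x / 4) ^ k / (2 * of_nat n)
        = of_nat ((n + k) choose (2 * k)) * of_nat ((2 * k) choose k)
            * (2 powi (- 2 * int k) / of_nat (n + k)) * x ^ k"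
      using assms by (simp add: power_divide mult_ac)
  qed
  finally show ?thesis by (simp add: atMost_atLeast0)
qed

end
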